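(* Let $s_1,\dots,s_d\in\Omega$. Any maximizer $f$ over $\mathcal{H}_{R_\infty}$ of $$\ell(f)=\sum_{i=1}^d\log\left(\frac{c}{2}f(s_i)^2\right)-\frac12\|f\|_{R_\infty}^2$$ can be written as $$f(s)=g(s)+(X\beta)(s),\qquad s\in\Omega,$$ for some function $g\in\mathcal{H}_K$ and some $\beta\in\mathbb{R}^p$.
   Context: Let $c,\gamma>0$ be real constants. Let $\Omega$ be a compact domain (a compact subset of a Euclidean space) equipped with a finite Borel measure $\mu$ of full support (every nonempty relatively open subset of $\Omega$ has positive measure), and let $\mathcal{L}^2(\Omega)=\mathcal{L}^2(\Omega,\mu)$ (real-valued), with inner product $\langle\cdot,\cdot\rangle$. Continuous functions on $\Omega$ are identified with their classes in $\mathcal{L}^2(\Omega)$. Let $k:\Omega\times\Omega\to\mathbb{R}$ be continuous, symmetric and positive-definite (i.e. $\sum_{i,j}b_ib_jk(s_i,s_j)\ge 0$ for all finite families of points $s_i\in\Omega$ and reals $b_i$), with integral operator $Kf(s)=\int_\Omega k(s,t)f(t)\,d\mu(t)$ on $\mathcal{L}^2(\Omega)$ and RKHS $\mathcal{H}_K$. Let $x_1,\dots,x_p\in C(\Omega)$ be linearly independent (it is not assumed that the $x_j$ lie in $\mathcal{H}_K$, nor that their span meets $\mathcal{H}_K$ only in $0$), and let $X\beta=\sum_{j=1}^p\beta_jx_j$ for $\beta\in\mathbb{R}^p$; its adjoint is $X^*h=(\langle h,x_j\rangle)_{j=1}^p$ for $h\in\mathcal{L}^2(\Omega)$. Set $A=cK+\gamma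 I$ (boundedly invertible on $\mathcal{L}^2(\Omega)$), $S=X^*A^{-1}X$ (an invertible $p\times p$ matrix), and $a_i=A^{-1}x_i$ (which is a continuous function). Let $r_0$ be the continuous kernel function of the integral operator $R_0=K(cK+\gamma I)^{-1}$, and $$r_\infty(s,t)=r_0(s,t)+\frac{\gamma}{c}\sum_{i,j=1}^p(S^{-1})_{ij}\,a_i(s)a_j(t).$$ This is the continuous symmetric positive-definite kernel of the integral operator $R_\infty=\frac{1}{c}\left(I-\gamma\left(A^{-1}-A^{-1}XS^{-1}X^*A^{-1}\right)\right)$. $\mathcal{H}_{R_\infty}$ is the RKHS with reproducing kernel $r_\infty$ and $\|\cdot\|_{R_\infty}$ its norm. Convention: $\log 0=-\infty$, and a maximizer of $\ell$ is an $f\in\mathcal{H}_{R_\infty}$ with $\ell(f)>-\infty$ and $\ell(f)\ge\ell(h)$ for all $h\in\mathcal{H}_{R_\infty}$. *)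

theory Defs
  imports "HOL-Analysis.Analysis"
begin

text \<open>
  Elements of \<open>L\<^sup>2(\<mu>)\<close> are represented by measurable square-integrable functions, and two
  representatives are identified when they agree almost everywhere.
\<close>

definition L2 :: "'a measure \<Rightarrow> ('a \<Rightarrow> real) set" where
  "L2 M = {f \<in> borel_measurable M. integrable M (\<lambda>s. (f s)\<^sup>2)}"

definition L2_inner :: "'a measure \<Rightarrow> ('a \<Rightarrow> real) \<Rightarrow> ('a \<Rightarrow> real) \<Rightarrow> real" where
  "L2_inner M f g = (LINT s|M. f s * g s)"

text \<open>
  The inverse of an operator \<open>T\<close> that is bijective on \<open>L\<^sup>2\<close>: the class of the result is then
  uniquely determined, and the choice operator only picks a representative.
\<close>

definition L2_inverse ::
  "'a measure \<Rightarrow> (('a \<Rightarrow> real) \<Rightarrow> 'a \<Rightarrow> real) \<Rightarrow> ('a \<Rightarrow> real) \<Rightarrow> 'a \<Rightarrow> real" where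
  "L2_inverse M T f = (SOME h. h \<in> L2 M \<and> (AE s in M. T h s = f s))"

definition integral_op ::
  "'a measure \<Rightarrow> ('a \<Rightarrow> 'a \<Rightarrow> real) \<Rightarrow> ('a \<Rightarrow> real) \<Rightarrow> 'a \<Rightarrow> real" where
  "integral_op M k f s = (LINT t|M. k s t * f t)"

definition continuous_L2_rep ::
  "'a::topological_space measure \<Rightarrow> ('a \<Rightarrow> real) \<Rightarrow> ('a \<Rightarrow> real) \<Rightarrow> bool" where
  "continuous_L2_rep M f g \<longleftrightarrow>
     continuous_on (space M) g \<and> (AE s in M. g s = f s)"

definition continuous_kernel_of ::
  "'a::topological_space measure \<Rightarrow> (('a \<Rightarrow> real) \<Rightarrow> 'a \<Rightarrow> real) \<Rightarrow> ('a \<Rightarrow> 'a \<Rightarrow> real) \<Rightarrow> bool" where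
  "continuous_kernel_of M T r \<longleftrightarrow>
     continuous_on (space M \<times> space M) (\<lambda>(s, t). r s t) \<and>
     (\<forall>f \<in> L2 M. AE s in M. integral_op M r f s = T f s)"

definition full_support_on :: "'a::topological_space set \<Rightarrow> 'a measure \<Rightarrow> bool" where
  "full_support_on \<Omega> M \<longleftrightarrow>
     (\<forall>U. openin (top_of_set \<Omega>) U \<and> U \<noteq> {} \<longrightarrow> 0 < emeasure M U)"

definition symmetric_kernel :: "'a set \<Rightarrow> ('a \<Rightarrow> 'a \<Rightarrow> real) \<Rightarrow> bool" where
  "symmetric_kernel \<Omega> k \<longleftrightarrow> (\<forall>s\<in>\<Omega>. \<forall>t\<in>\<Omega>. k s t = k t s)"

definition positive_definite_kernel :: "'a set \<Rightarrow> ('a \<Rightarrow> 'a \<Rightarrow> real) \<Rightarrow> bool" where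
  "positive_definite_kernel \<Omega> k \<longleftrightarrow>
     (\<forall>(n::nat) (u :: nat \<Rightarrow> 'a) (b :: nat \<Rightarrow> real). (\<forall>i<n. u i \<in> \<Omega>) \<longrightarrow>
        0 \<le> (\<Sum>i<n. \<Sum>j<n. b i * b j * k (u i) (u j)))"

text \<open>
  Functions on \<open>\<Omega>\<close> belonging to a function space are represented by total functions that vanish
  outside \<open>\<Omega>\<close>, so that equality of functions on \<open>\<Omega>\<close> is equality in HOL.
\<close>

locale hilbert_function_space =
  fixes \<Omega> :: "'a set"
    and H :: "('a \<Rightarrow> real) set"
    and ip :: "('a \<Rightarrow> real) \<Rightarrow> ('a \<Rightarrow> real) \<Rightarrow> real"
  assumes vanish_outside: "f \<in> H \<Longrightarrow> s \<notin> \<Omega> \<Longrightarrow> f s = 0"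
    and zero_mem: "(\<lambda>_. 0) \<in> H"
    and add_mem: "f \<in> H \<Longrightarrow> g \<in> H \<Longrightarrow> (\<lambda>s. f s + g s) \<in> H"
    and scale_mem: "f \<in> H \<Longrightarrow> (\<lambda>s. b * f s) \<in> H"
    and ip_commute: "f \<in> H \<Longrightarrow> g \<in> H \<Longrightarrow> ip f g = ip g f"
    and ip_add: "f \<in> H \<Longrightarrow> g \<in> H \<Longrightarrow> h \<in> H \<Longrightarrow> ip (\<lambda>s. f s + g s) h = ip f h + ip g h"
    and ip_scale: "f \<in> H \<Longrightarrow> g \<in> H \<Longrightarrow> ip (\<lambda>s. b * f s) g = b * ip f g"
    and ip_nonneg: "f \<in> H \<Longrightarrow> 0 \<le> ip f f"
    and ip_definite: "f \<in> H \<Longrightarrow> ip f f = 0 \<Longrightarrow> f = (\<lambda>_. 0)"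
    and complete:
      "(\<And>n::nat. F n \<in> H) \<Longrightarrow>
       (\<And>e. e > 0 \<Longrightarrow> \<exists>N. \<forall>m\<ge>N. \<forall>n\<ge>N.
          sqrt (ip (\<lambda>s. F m s - F n s) (\<lambda>s. F m s - F n s)) < e) \<Longrightarrow>
       \<exists>f\<in>H. (\<lambda>n. sqrt (ip (\<lambda>s. F n s - f s) (\<lambda>s. F n s - f s))) \<longlonglongrightarrow> 0"

definition kernel_section :: "'a set \<Rightarrow> ('a \<Rightarrow> 'a \<Rightarrow> real) \<Rightarrow> 'a \<Rightarrow> 'a \<Rightarrow> real" where
  "kernel_section \<Omega> k s = (\<lambda>t. if t \<in> \<Omega> then k t s else 0)"

text \<open>
  By the Moore--Aronszajn theorem, the pair \<open>(H, ip)\<close> (with \<open>ip\<close> restricted to \<open>H\<close>) exists and is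
  unique for a given symmetric positive-definite \<open>k\<close>.
\<close>

locale rkhs = hilbert_function_space \<Omega> H ip
  for \<Omega> :: "'a set" and k :: "'a \<Rightarrow> 'a \<Rightarrow> real" and H ip +
  assumes section_mem: "s \<in> \<Omega> \<Longrightarrow> kernel_section \<Omega> k s \<in> H"
    and reproducing: "s \<in> \<Omega> \<Longrightarrow> f \<in> H \<Longrightarrow> ip f (kernel_section \<Omega> k s) = f s"

definition rkhs_norm :: "(('a \<Rightarrow> real) \<Rightarrow> ('a \<Rightarrow> real) \<Rightarrow> real) \<Rightarrow> ('a \<Rightarrow> real) \<Rightarrow> real" where
  "rkhs_norm ip f = sqrt (ip f f)"

definition X_op :: "('p::finite \<Rightarrow> 'a \<Rightarrow> real) \<Rightarrow> real ^ 'p \<Rightarrow> 'a \<Rightarrow> real" where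
  "X_op x \<beta> s = (\<Sum>j\<in>UNIV. \<beta> $ j * x j s)"

definition X_adj :: "'a measure \<Rightarrow> ('p::finite \<Rightarrow> 'a \<Rightarrow> real) \<Rightarrow> ('a \<Rightarrow> real) \<Rightarrow> real ^ 'p" where
  "X_adj M x h = (\<chi> j. L2_inner M h (x j))"

definition linearly_independent_on :: "'a set \<Rightarrow> ('p::finite \<Rightarrow> 'a \<Rightarrow> real) \<Rightarrow> bool" where
  "linearly_independent_on \<Omega> x \<longleftrightarrow> (\<forall>\<beta>. (\<forall>s\<in>\<Omega>. X_op x \<beta> s = 0) \<longrightarrow> \<beta> = 0)"

definition A_op ::
  "'a measure \<Rightarrow> ('a \<Rightarrow> 'a \<Rightarrow> real) \<Rightarrow> real \<Rightarrow> real \<Rightarrow> ('a \<Rightarrow> real) \<Rightarrow> 'a \<Rightarrow> real" where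
  "A_op M k c \<gamma> f s = c * integral_op M k f s + \<gamma> * f s"

definition A_inv ::
  "'a measure \<Rightarrow> ('a \<Rightarrow> 'a \<Rightarrow> real) \<Rightarrow> real \<Rightarrow> real \<Rightarrow> ('a \<Rightarrow> real) \<Rightarrow> 'a \<Rightarrow> real" where
  "A_inv M k c \<gamma> = L2_inverse M (A_op M k c \<gamma>)"

definition R0_op ::
  "'a measure \<Rightarrow> ('a \<Rightarrow> 'a \<Rightarrow> real) \<Rightarrow> real \<Rightarrow> real \<Rightarrow> ('a \<Rightarrow> real) \<Rightarrow> 'a \<Rightarrow> real" where
  "R0_op M k c \<gamma> f = integral_op M k (A_inv M k c \<gamma> f)"

definition S_mat ::
  "'a measure \<Rightarrow> ('a \<Rightarrow> 'a \<Rightarrow> real) \<Rightarrow> real \<Rightarrow> real \<Rightarrow> ('p::finite \<Rightarrow> 'a \<Rightarrow> real) \<Rightarrow> real ^ 'p ^ 'p"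
  where
  "S_mat M k c \<gamma> x = matrix (\<lambda>\<beta>. X_adj M x (A_inv M k c \<gamma> (X_op x \<beta>)))"

definition r_inf ::
  "real \<Rightarrow> real \<Rightarrow> real ^ 'p ^ 'p \<Rightarrow> ('a \<Rightarrow> 'a \<Rightarrow> real) \<Rightarrow> ('p::finite \<Rightarrow> 'a \<Rightarrow> real)
    \<Rightarrow> 'a \<Rightarrow> 'a \<Rightarrow> real" where
  "r_inf c \<gamma> S r0 a s t =
     r0 s t + \<gamma> / c * (\<Sum>i\<in>UNIV. \<Sum>j\<in>UNIV. matrix_inv S $ i $ j * a i s * a j t)"

text \<open>The logarithm on \<open>[0, \<infinity>)\<close> with \<open>log 0 = -\<infinity>\<close>; HOL's \<open>ln\<close> has \<open>ln 0 = 0\<close>.\<close>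

definition elog :: "real \<Rightarrow> ereal" where
  "elog y = (if y = 0 then -\<infinity> else ereal (ln y))"

definition ell ::
  "real \<Rightarrow> nat \<Rightarrow> (nat \<Rightarrow> 'a) \<Rightarrow> (('a \<Rightarrow> real) \<Rightarrow> ('a \<Rightarrow> real) \<Rightarrow> real) \<Rightarrow> ('a \<Rightarrow> real) \<Rightarrow> ereal" where
  "ell c d s ip f =
     (\<Sum>i=1..d. elog (c / 2 * (f (s i))\<^sup>2)) - ereal (1 / 2 * (rkhs_norm ip f)\<^sup>2)"

definition is_maximizer :: "('b \<Rightarrow> ereal) \<Rightarrow> 'b set \<Rightarrow> 'b \<Rightarrow> bool" where
  "is_maximizer L H f \<longleftrightarrow> f \<in> H \<and> L f > -\<infinity> \<and> (\<forall>h\<in>H. L h \<le> L f)"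

end

theory Submission
  imports Defs
begin

text \<open>
  Write \<open>K\<close> for the integral operator of \<open>k\<close> and \<open>A = cK + \<gamma>I\<close>. The first-order condition at a
  maximizer \<open>f\<close>, in the direction \<open>f - \<Sum>\<^sub>i 2/f(s\<^sub>i) r\<^sub>\<infinity>(\<cdot>,s\<^sub>i)\<close>, forces this direction to vanish; so \<open>f\<close>
  is a combination of the sections \<open>r\<^sub>\<infinity>(\<cdot>,s\<^sub>i)\<close>, and it suffices to decompose \<open>r\<^sub>0(\<cdot>,t)\<close> and each \<open>a\<^sub>i\<close>.
  By Riesz representation \<open>K\<close> maps \<open>L\<^sup>2\<close> into \<open>H\<^sub>K\<close>. If \<open>A h = y\<close> then \<open>h = (y - cKh)/\<gamma>\<close>, which
  applies to \<open>A a\<^sub>i = x\<^sub>i\<close> and to \<open>A r\<^sub>0(\<cdot>,t) = k(\<cdot>,t)\<close>.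
\<close>

section \<open>Hilbert space theory for function spaces: Cauchy-Schwarz and Riesz
  representation\<close>

lemma linear_coeff_eq_zero:
  fixes a b :: real
  assumes "\<And>t. 0 \<le> 2 * t * a + t\<^sup>2 * b"
  shows "a = 0"
proof (rule ccontr)
  assume a: "a \<noteq> 0"
  define e where "e = \<bar>b\<bar> + 1"
  have e: "e > 0" "b < e" by (auto simp: e_def)
  \<comment> \<open>For positive \<open>b\<close> the quadratic is minimal at
    \<open>- a / b\<close>. Replacing \<open>b\<close> by the positive \<open>e\<close> allows any
    sign of \<open>b\<close> and still leaves \<open>b / e < 1\<close>.\<close>
  have "0 \<le> 2 * (- a / e) * a + (- a / e)\<^sup>2 * b" by (rule assms)
  also have "\<dots> = (a\<^sup>2 / e) * (b / e - 2)"
    using e by (simp add: field_simps power2_eq_square)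
  also have "\<dots> < 0"
    using a e by (intro mult_pos_neg) (auto simp: field_simps)
  finally show False by simp
qed

context hilbert_function_space
begin

lemma diff_mem: "f \<in> H \<Longrightarrow> g \<in> H \<Longrightarrow> (\<lambda>s. f s - g s) \<in> H"
  using add_mem[OF _ scale_mem[of g "-1"], of f] by simp

lemma ip_diff:
  "f \<in> H \<Longrightarrow> g \<in> H \<Longrightarrow> h \<in> H \<Longrightarrow> ip (\<lambda>s. f s - g s) h = ip f h - ip g h"
  using ip_add[OF _ scale_mem[of g "-1"], of f h] ip_scale[of g h "-1"] by simp

lemma ip_zero: "g \<in> H \<Longrightarrow> ip (\<lambda>_. 0) g = 0"
  using ip_scale[of "\<lambda>_. 0" g 0] zero_mem by simp

lemma sum_mem:
  assumes "\<And>i. i \<in> I \<Longrightarrow> F i \<in> H"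
  shows "(\<lambda>s. \<Sum>i\<in>I. b i * F i s) \<in> H"
  using assms
proof (induction I rule: infinite_finite_induct)
  case (insert i I)
  then show ?case
    using add_mem[OF scale_mem[of "F i" "b i"], of "\<lambda>s. \<Sum>i\<in>I. b i * F i s"] by simp
qed (simp_all add: zero_mem)

lemma ip_sum:
  assumes "\<And>i. i \<in> I \<Longrightarrow> F i \<in> H" and "g \<in> H"
  shows "ip (\<lambda>s. \<Sum>i\<in>I. b i * F i s) g = (\<Sum>i\<in>I. b i * ip (F i) g)"
  using assms
proof (induction I rule: infinite_finite_induct)
  case (insert i I)
  then show ?case
    using ip_add[OF scale_mem[of "F i" "b i"] sum_mem[of I F b], of g]
    by (simp add: ip_scale)
qed (simp_all add: ip_zero)

lemma ip_self_add_scale: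
  assumes "f \<in> H" "g \<in> H"
  shows "ip (\<lambda>s. f s + t * g s) (\<lambda>s. f s + t * g s) = ip f f + 2 * t * ip f g + t\<^sup>2 * ip g g"
proof -
  let ?h = "\<lambda>s. f s + t * g s"
  have h: "?h \<in> H" using assms by (intro add_mem scale_mem)
  have *: "ip ?h z = ip f z + t * ip g z" if "z \<in> H" for z
    using that assms by (simp add: ip_add scale_mem ip_scale)
  have "ip ?h ?h = ip ?h f + t * ip ?h g"
    using *[OF h] assms h by (simp add: ip_commute)
  then show ?thesis
    using assms by (simp add: * ip_commute[of g f] power2_eq_square algebra_simps)
qed

lemma Cauchy_Schwarz_ip:
  assumes "f \<in> H" "g \<in> H"
  shows "(ip f g)\<^sup>2 \<le> ip f f * ip g g"
proof (cases "ip g g = 0")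
  case True
  then have "g = (\<lambda>_. 0)" using assms ip_definite by blast
  then have "ip f g = 0" using assms ip_commute ip_zero by simp
  then show ?thesis using True by simp
next
  case False
  then have pos: "ip g g > 0" using ip_nonneg[OF assms(2)] by simp
  \<comment> \<open>The coefficient is the one that minimises the norm of \<open>f + t * g\<close>
    over all \<open>t\<close>.\<close>
  have "0 \<le> ip f f + 2 * (- ip f g / ip g g) * ip f g + (- ip f g / ip g g)\<^sup>2 * ip g g"
    using ip_nonneg[OF add_mem[OF assms(1) scale_mem[OF assms(2)]]]
    unfolding ip_self_add_scale[OF assms] .
  also have "\<dots> = ip f f - (ip f g)\<^sup>2 / ip g g"
    using pos by (simp add: field_simps power2_eq_square)
  finally show ?thesis using pos by (simp add: field_simps)
qed

lemma abs_ip_le: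
  assumes "f \<in> H" "g \<in> H"
  shows "\<bar>ip f g\<bar> \<le> sqrt (ip f f) * sqrt (ip g g)"
proof -
  have "sqrt ((ip f g)\<^sup>2) \<le> sqrt (ip f f * ip g g)"
    using Cauchy_Schwarz_ip[OF assms] by (rule real_sqrt_le_mono)
  then show ?thesis by (simp only: real_sqrt_abs real_sqrt_mult)
qed

text \<open>Direct method: a representer \<open>w\<close> would give \<open>J g\<close> the value of
  the squared distance from \<open>g\<close> to \<open>w\<close>, up to a constant, so
  \<open>w\<close> is sought as a minimiser of \<open>J\<close>. Boundedness of \<open>L\<close>
  bounds \<open>J\<close> below, the parallelogram law makes minimising sequences Cauchy, and
  \<open>complete\<close> supplies the limit.\<close>

lemma Riesz_representation:
  assumes add: "\<And>f g. f \<in> H \<Longrightarrow> g \<in> H \<Longrightarrow> L (\<lambda>s. f s + g s) = L f + L g"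
    and scale: "\<And>f b. f \<in> H \<Longrightarrow> L (\<lambda>s. b * f s) = b * L f"
    and bounded: "\<And>f. f \<in> H \<Longrightarrow> \<bar>L f\<bar> \<le> C * sqrt (ip f f)"
  obtains w where "w \<in> H" "\<And>f. f \<in> H \<Longrightarrow> ip w f = L f"
proof -
  define J where "J g = ip g g - 2 * L g" for g
  have J_ge: "- C\<^sup>2 \<le> J g" if "g \<in> H" for g
  proof -
    have "0 \<le> (sqrt (ip g g) - C)\<^sup>2" by simp
    also have "\<dots> = ip g g - 2 * (C * sqrt (ip g g)) + C\<^sup>2"
      using ip_nonneg[OF that] by (simp add: power2_diff)
    finally show ?thesis using bounded[OF that] by (simp add: J_def)
  qed
  have bdd: "bdd_below (J ` H)" using J_ge by (intro bdd_belowI[of _ "- C\<^sup>2"]) auto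
  define m where "m = Inf (J ` H)"
  have m_le: "m \<le> J g" if "g \<in> H" for g
    unfolding m_def using that bdd by (intro cInf_lower) auto
  have "\<exists>g\<in>H. J g < m + 1 / real (Suc n)" for n
    using cInf_lessD[of "J ` H" "m + 1 / real (Suc n)"] zero_mem by (auto simp: m_def)
  then obtain G where G: "\<And>n. G n \<in> H" and JG: "\<And>n. J (G n) < m + 1 / real (Suc n)"
    by metis
  \<comment> \<open>By the parallelogram law the squared distance is
    \<open>2 * J (G i) + 2 * J (G j) - 4 * J ?A\<close> for the midpoint \<open>?A\<close>. There
    \<open>J\<close> is at least \<open>m\<close>, so only the two excesses over \<open>m\<close>
    remain.\<close>
  have close: "ip (\<lambda>s. G i s - G j s) (\<lambda>s. G i s - G j s) < 2 / real (Suc i) + 2 / real (Suc j)"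
    for i j
  proof -
    \<comment> \<open>The factor 1 gives \<open>?S\<close> the shape required by
      \<open>ip_self_add_scale\<close>.\<close>
    let ?D = "\<lambda>s. G i s - G j s" and ?S = "\<lambda>s. G i s + 1 * G j s"
    let ?A = "\<lambda>s. (1 / 2) * ?S s"
    have S: "?S \<in> H" using G by (intro add_mem scale_mem)
    have A: "?A \<in> H" using S by (rule scale_mem)
    have "ip ?A ?A = 1 / 2 * ip ?S ?A" using S A by (rule ip_scale)
    also have "ip ?S ?A = ip ?A ?S" using S A by (rule ip_commute)
    also have "\<dots> = 1 / 2 * ip ?S ?S" using S S by (rule ip_scale)
    also have "ip ?S ?S = ip (G i) (G i) + 2 * 1 * ip (G i) (G j) + 1\<^sup>2 * ip (G j) (G j)"
      by (rule ip_self_add_scale[OF G G])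
    finally have "ip ?A ?A = 1/4 * (ip (G i) (G i) + 2 * ip (G i) (G j) + ip (G j) (G j))"
      by simp
    moreover have "ip ?D ?D = ip (G i) (G i) - 2 * ip (G i) (G j) + ip (G j) (G j)"
      using ip_self_add_scale[of "G i" "G j" "-1"] G by simp
    moreover have "L ?A = (L (G i) + L (G j)) / 2"
      using scale[OF S, of "1 / 2"] add[OF G G] by simp
    ultimately have "ip ?D ?D = 2 * J (G i) + 2 * J (G j) - 4 * J ?A"
      by (simp add: J_def)
    then show ?thesis
      using JG[of i] JG[of j] m_le[OF A] by simp
  qed
  have "\<exists>N. \<forall>i\<ge>N. \<forall>j\<ge>N. sqrt (ip (\<lambda>s. G i s - G j s) (\<lambda>s. G i s - G j s)) < e"
    if e: "e > 0" for e
  proof -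
    obtain N where N: "4 / real (Suc N) < e\<^sup>2"
      using e reals_Archimedean[of "e\<^sup>2 / 4"] by (auto simp: field_simps)
    have "sqrt (ip (\<lambda>s. G i s - G j s) (\<lambda>s. G i s - G j s)) < e" if "i \<ge> N" "j \<ge> N" for i j
    proof -
      have "2 / real (Suc i) \<le> 2 / real (Suc N)" "2 / real (Suc j) \<le> 2 / real (Suc N)"
        using that by (auto simp: field_simps)
      then have "ip (\<lambda>s. G i s - G j s) (\<lambda>s. G i s - G j s) < e\<^sup>2"
        using close[of i j] N by simp
      then show ?thesis
        using e by (metis real_sqrt_less_mono real_sqrt_unique less_imp_le)
    qed
    then show ?thesis by blast
  qed
  from complete[OF G this] obtain w where w: "w \<in> H"
    and lim: "(\<lambda>n. sqrt (ip (\<lambda>s. G n s - w s) (\<lambda>s. G n s - w s))) \<longlonglongrightarrow> 0"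
    by blast
  have "ip w h = L h" if h: "h \<in> H" for h
  proof -
    have "(\<lambda>n. ip (G n) h - ip w h) \<longlonglongrightarrow> 0"
    proof (rule Lim_null_comparison)
      show "\<forall>\<^sub>F n in sequentially. norm (ip (G n) h - ip w h)
          \<le> sqrt (ip (\<lambda>s. G n s - w s) (\<lambda>s. G n s - w s)) * sqrt (ip h h)"
        using abs_ip_le[OF diff_mem[OF G w] h] by (simp add: ip_diff[OF G w h])
      show "(\<lambda>n. sqrt (ip (\<lambda>s. G n s - w s) (\<lambda>s. G n s - w s)) * sqrt (ip h h)) \<longlonglongrightarrow> 0"
        using tendsto_mult_right[OF lim, of "sqrt (ip h h)"] by simp
    qed
    then have limh: "(\<lambda>n. ip (G n) h) \<longlonglongrightarrow> ip w h"
      by (simp add: LIM_zero_iff)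
    have "ip w h - L h = 0"
    proof (rule linear_coeff_eq_zero)
      fix t
      \<comment> \<open>Near-minimality of \<open>G n\<close> gives the quadratic inequality up to
        an error \<open>1 / real (Suc n)\<close>. The limit in \<open>n\<close> removes the error
        and replaces \<open>G n\<close> by \<open>w\<close>, without an appeal to continuity of
        \<open>J\<close>.\<close>
      have "0 \<le> 2 * t * (ip (G n) h - L h) + t\<^sup>2 * ip h h + 1 / real (Suc n)" for n
      proof -
        have "m \<le> J (\<lambda>s. G n s + t * h s)"
          using G h by (intro m_le add_mem scale_mem)
        also have "\<dots> = J (G n) + 2 * t * (ip (G n) h - L h) + t\<^sup>2 * ip h h"
          using G h by (simp add: J_def ip_self_add_scale add scale scale_mem algebra_simps)
        finally show ?thesis using JG[of n] by simp
      qed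
      moreover have "(\<lambda>n. 2 * t * (ip (G n) h - L h) + t\<^sup>2 * ip h h + 1 / real (Suc n))
          \<longlonglongrightarrow> 2 * t * (ip w h - L h) + t\<^sup>2 * ip h h + 0"
        by (intro tendsto_intros limh LIMSEQ_inverse_real_of_nat[unfolded inverse_eq_divide])
      ultimately show "0 \<le> 2 * t * (ip w h - L h) + t\<^sup>2 * ip h h"
        by (intro LIMSEQ_le_const) auto
    qed
    then show ?thesis by simp
  qed
  with w that show ?thesis by blast
qed

end

section \<open>Reproducing kernels: evaluation, the first-order condition at a maximizer, and
  continuity\<close>

context rkhs
begin

lemma abs_eval_le:
  assumes "s \<in> \<Omega>" "f \<in> H"
  shows "\<bar>f s\<bar> \<le> sqrt (k s s) * sqrt (ip f f)"
  using abs_ip_le[OF assms(2) section_mem[OF assms(1)]] reproducing assms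
    reproducing[OF assms(1) section_mem[OF assms(1)]]
  by (simp add: kernel_section_def mult.commute)

text \<open>Both values are the inner product of the two kernel sections, taken in either
  order.\<close>

lemma kernel_symmetric:
  assumes "s \<in> \<Omega>" "t \<in> \<Omega>"
  shows "k s t = k t s"
  using ip_commute[OF section_mem[OF assms(1)] section_mem[OF assms(2)]] assms
    reproducing[OF assms(2) section_mem[OF assms(1)]]
    reproducing[OF assms(1) section_mem[OF assms(2)]]
  by (simp add: kernel_section_def)

text \<open>One direction suffices: for \<open>h = f - g\<close>, with \<open>g\<close> the expected
  expansion, the derivative of the objective along \<open>f + t * h\<close> at 0 is
  \<open>ip g h - ip f h = - ip h h\<close> by the reproducing property. It vanishes at a maximizer,
  hence \<open>h = 0\<close>.\<close>

lemma maximizer_expansion: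
  assumes c: "c > 0" and s: "\<And>i. i \<in> {1..d} \<Longrightarrow> s i \<in> \<Omega>"
    and max: "is_maximizer (ell c d s ip) H f"
  shows "\<forall>u\<in>\<Omega>. f u = (\<Sum>i=1..d. 2 / f (s i) * k u (s i))"
proof -
  have f: "f \<in> H" and fin: "ell c d s ip f > -\<infinity>"
    and le: "\<And>h. h \<in> H \<Longrightarrow> ell c d s ip h \<le> ell c d s ip f"
    using max by (auto simp: is_maximizer_def)
  have nz: "f (s i) \<noteq> 0" if i: "i \<in> {1..d}" for i
  proof
    assume 0: "f (s i) = 0"
    let ?e = "\<lambda>i. elog (c / 2 * (f (s i))\<^sup>2)"
    have "sum ?e {1..d} = ?e i + sum ?e ({1..d} - {i})"
      using i by (intro sum.remove) auto
    \<comment> \<open>In \<open>ereal\<close> the sum of minus and plus infinity is plus infinity,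
      so the rest must be known not to be plus infinity before one zero sample can force the whole
      sum to minus infinity.\<close>
    moreover have "sum ?e ({1..d} - {i}) \<noteq> \<infinity>"
      unfolding sum_Pinfty by (auto simp: elog_def)
    ultimately have "sum ?e {1..d} = -\<infinity>"
      using 0 by (cases "sum ?e ({1..d} - {i})") (auto simp: elog_def)
    then show False using fin by (simp add: ell_def)
  qed
  define g where "g = (\<lambda>u. \<Sum>i=1..d. (2 / f (s i)) * kernel_section \<Omega> k (s i) u)"
  define h where "h = (\<lambda>u. f u - g u)"
  have g: "g \<in> H" unfolding g_def using s by (intro sum_mem section_mem) auto
  have h: "h \<in> H" unfolding h_def using f g by (rule diff_mem)
  \<comment> \<open>The real-valued objective along the line. Using \<open>ln\<close> for
    \<open>elog\<close> is legitimate only where no sample of \<open>f + t * h\<close> vanishes,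
    which \<open>nz\<close> and continuity guarantee for small \<open>t\<close>.\<close>
  define \<phi> where "\<phi> t = (\<Sum>i=1..d. ln (c / 2 * (f (s i) + t * h (s i))\<^sup>2))
      - 1 / 2 * (ip f f + 2 * t * ip f h + t\<^sup>2 * ip h h)" for t
  have ell_eq: "ell c d s ip (\<lambda>u. f u + t * h u) = ereal (\<phi> t)"
    if "\<And>i. i \<in> {1..d} \<Longrightarrow> f (s i) + t * h (s i) \<noteq> 0" for t
  proof -
    have "(\<Sum>i=1..d. elog (c / 2 * (f (s i) + t * h (s i))\<^sup>2)) =
        (\<Sum>i=1..d. ereal (ln (c / 2 * (f (s i) + t * h (s i))\<^sup>2)))"
      using that c by (intro sum.cong) (auto simp: elog_def)
    moreover have "0 \<le> ip (\<lambda>u. f u + t * h u) (\<lambda>u. f u + t * h u)"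
      using f h by (intro ip_nonneg add_mem scale_mem)
    ultimately show ?thesis
      using f h by (simp add: ell_def \<phi>_def rkhs_norm_def ip_self_add_scale)
  qed
  have ev: "\<forall>\<^sub>F t in nhds 0. \<forall>i\<in>{1..d}. f (s i) + t * h (s i) \<noteq> 0"
  proof (intro eventually_ball_finite ballI)
    fix i assume i: "i \<in> {1..d}"
    have "((\<lambda>t. f (s i) + t * h (s i)) \<longlongrightarrow> f (s i) + 0 * h (s i)) (nhds 0)"
      by (intro tendsto_intros filterlim_ident)
    then show "\<forall>\<^sub>F t in nhds 0. f (s i) + t * h (s i) \<noteq> 0"
      using nz[OF i] by (intro tendsto_imp_eventually_ne) auto
  qed simp
  obtain e where e: "e > 0"
    and ne: "\<And>t i. \<bar>t\<bar> < e \<Longrightarrow> i \<in> {1..d} \<Longrightarrow> f (s i) + t * h (s i) \<noteq> 0"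
    using ev unfolding eventually_nhds_metric by (auto simp: dist_real_def)
  have local_max: "\<forall>y. \<bar>0 - y\<bar> < e \<longrightarrow> \<phi> y \<le> \<phi> 0"
  proof (intro allI impI)
    fix y :: real assume "\<bar>0 - y\<bar> < e"
    then have "ell c d s ip (\<lambda>u. f u + y * h u) = ereal (\<phi> y)"
      using ne by (intro ell_eq) simp
    moreover have "ell c d s ip (\<lambda>u. f u + 0 * h u) = ereal (\<phi> 0)"
      using nz by (intro ell_eq) simp
    ultimately show "\<phi> y \<le> \<phi> 0"
      using le[OF add_mem[OF f scale_mem[OF h, of y]]] by simp
  qed
  have "((\<lambda>t. ln (c / 2 * (f (s i) + t * h (s i))\<^sup>2)) has_real_derivative
      2 / f (s i) * h (s i)) (at 0)" if "i \<in> {1..d}" for i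
  proof -
    have pos: "0 < c / 2 * (f (s i) + 0 * h (s i))\<^sup>2" using nz[OF that] c by simp
    have "((\<lambda>t. c / 2 * (f (s i) + t * h (s i))\<^sup>2) has_real_derivative
        c * f (s i) * h (s i)) (at 0)"
      by (auto intro!: derivative_eq_intros)
    from DERIV_chain2[OF DERIV_ln_divide[OF pos] this]
    show ?thesis using nz[OF that] c by (simp add: power2_eq_square)
  qed
  then have "((\<lambda>t. \<Sum>i=1..d. ln (c / 2 * (f (s i) + t * h (s i))\<^sup>2)) has_real_derivative
      (\<Sum>i=1..d. 2 / f (s i) * h (s i))) (at 0)"
    by (intro DERIV_sum)
  moreover have "((\<lambda>t. 1 / 2 * (ip f f + 2 * t * ip f h + t\<^sup>2 * ip h h)) has_real_derivative
      ip f h) (at 0)"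
    by (auto intro!: derivative_eq_intros)
  ultimately have "(\<phi> has_real_derivative (\<Sum>i=1..d. 2 / f (s i) * h (s i)) - ip f h) (at 0)"
    unfolding \<phi>_def by (rule DERIV_diff)
  then have "(\<Sum>i=1..d. 2 / f (s i) * h (s i)) = ip f h"
    using DERIV_local_max[OF _ e local_max] by fastforce
  also have "(\<Sum>i=1..d. 2 / f (s i) * h (s i)) = ip g h"
    unfolding g_def using s h
    by (subst ip_sum) (auto intro!: sum.cong simp: section_mem ip_commute[of _ h] reproducing)
  finally have "ip h h = 0"
    using ip_diff[OF f g h] by (simp add: h_def)
  then have "h = (\<lambda>_. 0)" by (rule ip_definite[OF h])
  then have fg: "f u = g u" for u unfolding h_def by (metis eq_iff_diff_eq_0)
  show ?thesis
    by (subst fg) (simp add: g_def kernel_section_def)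
qed

end

text \<open>The squared distance between the sections at \<open>u n\<close> and \<open>s\<close> is
  \<open>k (u n) (u n) - 2 * k (u n) s + k s s\<close>, which tends to 0 by continuity of
  \<open>k\<close>; Cauchy-Schwarz passes this on to \<open>f\<close>. The lemma stands outside the
  locale because the points need a topology.\<close>

lemma rkhs_mem_continuous_on:
  fixes \<Omega> :: "'a::{first_countable_topology, t2_space} set"
  assumes "rkhs \<Omega> k H ip"
    and k: "continuous_on (\<Omega> \<times> \<Omega>) (\<lambda>(s, t). k s t)" and f: "f \<in> H"
  shows "continuous_on \<Omega> f"
proof -
  interpret rkhs \<Omega> k H ip by fact
  show ?thesis
  proof (rule continuous_on_sequentiallyI)
    fix u s assume s: "s \<in> \<Omega>" and u: "\<forall>n. u n \<in> \<Omega>" and lim: "u \<longlonglongrightarrow> s"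
    let ?D = "\<lambda>n v. kernel_section \<Omega> k (u n) v - kernel_section \<Omega> k s v"
    have ip_D: "ip (?D n) (?D n) = k (u n) (u n) - 2 * k (u n) s + k s s" for n
      using ip_self_add_scale[of "kernel_section \<Omega> k (u n)" "kernel_section \<Omega> k s" "-1"] s u
      by (simp add: reproducing section_mem) (simp add: kernel_section_def kernel_symmetric)
    have kl: "(\<lambda>n. k (p n) (q n)) \<longlonglongrightarrow> k s s"
      if "p \<longlonglongrightarrow> s" "q \<longlonglongrightarrow> s" "\<And>n. p n \<in> \<Omega>" "\<And>n. q n \<in> \<Omega>" for p q
      using continuous_on_tendsto_compose[OF k tendsto_Pair[OF that(1,2)]] s that by simp
    have "(\<lambda>n. k (u n) (u n) - 2 * k (u n) s + k s s) \<longlonglongrightarrow> k s s - 2 * k s s + k s s"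
      by (intro tendsto_intros kl lim) (use u s in auto)
    then have lim0: "(\<lambda>n. sqrt (ip f f) * sqrt (ip (?D n) (?D n))) \<longlonglongrightarrow> sqrt (ip f f) * sqrt 0"
      unfolding ip_D by (intro tendsto_intros) simp
    have bound: "norm (f (u n) - f s) \<le> sqrt (ip f f) * sqrt (ip (?D n) (?D n))" for n
    proof -
      have sec: "kernel_section \<Omega> k (u n) \<in> H" "kernel_section \<Omega> k s \<in> H"
        using u s by (auto intro: section_mem)
      have "ip f (?D n) = ip (?D n) f" using f sec by (intro ip_commute diff_mem)
      also have "\<dots> = ip f (kernel_section \<Omega> k (u n)) - ip f (kernel_section \<Omega> k s)"
        using ip_diff[OF sec f] ip_commute[OF sec(1) f] ip_commute[OF sec(2) f] by simp
      also have "\<dots> = f (u n) - f s" using f s u by (simp add: reproducing)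
      finally have eq: "ip f (?D n) = f (u n) - f s" .
      show ?thesis
        using abs_ip_le[OF f diff_mem[OF sec]] unfolding eq real_norm_def .
    qed
    have "(\<lambda>n. f (u n) - f s) \<longlonglongrightarrow> 0"
      by (rule Lim_null_comparison[OF always_eventually[OF allI[OF bound]]])
        (use lim0 in \<open>simp only: real_sqrt_zero mult_zero_right\<close>)
    then show "(\<lambda>n. f (u n)) \<longlonglongrightarrow> f s" by (simp add: LIM_zero_iff)
  qed
qed

section \<open>Square-integrable functions and their inner product\<close>

lemma L2_inner_commute: "L2_inner M f g = L2_inner M g f"
  by (simp add: L2_inner_def mult.commute)

lemma L2_inner_cong:
  "(\<And>s. s \<in> space M \<Longrightarrow> f s = f' s) \<Longrightarrow> (\<And>s. s \<in> space M \<Longrightarrow> g s = g' s) \<Longrightarrow>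
    L2_inner M f g = L2_inner M f' g'"
  unfolding L2_inner_def by (intro Bochner_Integration.integral_cong) auto

lemma L2_mult_integrable:
  assumes "f \<in> L2 M" "g \<in> L2 M"
  shows "integrable M (\<lambda>s. f s * g s)"
proof (rule Bochner_Integration.integrable_bound[where f = "\<lambda>s. (f s)\<^sup>2 + (g s)\<^sup>2"])
  have "\<bar>f s * g s\<bar> \<le> (f s)\<^sup>2 + (g s)\<^sup>2" for s
  proof -
    have "2 * \<bar>f s * g s\<bar> \<le> (f s)\<^sup>2 + (g s)\<^sup>2"
      using sum_squares_bound[of "\<bar>f s\<bar>" "\<bar>g s\<bar>"] by (simp add: abs_mult)
    then show ?thesis using abs_ge_zero[of "f s * g s"] by linarith
  qed
  then show "AE s in M. norm (f s * g s) \<le> norm ((f s)\<^sup>2 + (g s)\<^sup>2)" by simp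
qed (use assms in \<open>auto simp: L2_def\<close>)

lemma L2_add:
  assumes "f \<in> L2 M" "g \<in> L2 M"
  shows "(\<lambda>s. f s + g s) \<in> L2 M"
proof -
  have "integrable M (\<lambda>s. (f s)\<^sup>2 + 2 * (f s * g s) + (g s)\<^sup>2)"
    using assms L2_mult_integrable[OF assms]
    by (intro Bochner_Integration.integrable_add integrable_mult_right) (auto simp: L2_def)
  then show ?thesis
    using assms by (auto simp: L2_def power2_sum algebra_simps)
qed

lemma L2_scale: "f \<in> L2 M \<Longrightarrow> (\<lambda>s. b * f s) \<in> L2 M"
  by (auto simp: L2_def power_mult_distrib)

lemma L2_diff: "f \<in> L2 M \<Longrightarrow> g \<in> L2 M \<Longrightarrow> (\<lambda>s. f s - g s) \<in> L2 M"
  using L2_add[OF _ L2_scale[of g M "-1"], of f] by simp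

lemma L2_inner_add_left:
  "f \<in> L2 M \<Longrightarrow> g \<in> L2 M \<Longrightarrow> h \<in> L2 M \<Longrightarrow>
    L2_inner M (\<lambda>s. f s + g s) h = L2_inner M f h + L2_inner M g h"
  by (simp add: L2_inner_def L2_mult_integrable distrib_right)

lemma L2_inner_diff_left:
  "f \<in> L2 M \<Longrightarrow> g \<in> L2 M \<Longrightarrow> h \<in> L2 M \<Longrightarrow>
    L2_inner M (\<lambda>s. f s - g s) h = L2_inner M f h - L2_inner M g h"
  by (simp add: L2_inner_def L2_mult_integrable left_diff_distrib)

lemma L2_inner_scale_left: "L2_inner M (\<lambda>s. b * f s) h = b * L2_inner M f h"
  by (simp add: L2_inner_def mult.assoc)

lemma L2_inner_self_eq_0:
  assumes "f \<in> L2 M" "L2_inner M f f = 0"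
  shows "AE s in M. f s = 0"
proof -
  have "integral\<^sup>L M (\<lambda>s. (f s)\<^sup>2) = 0"
    using assms(2) by (simp add: L2_inner_def power2_eq_square)
  then have "AE s in M. (f s)\<^sup>2 = 0"
    using assms(1) by (subst (asm) integral_nonneg_eq_0_iff_AE) (auto simp: L2_def)
  then show ?thesis by simp
qed

section \<open>Continuous functions and kernels on a compact set carrying a finite measure of full
  support\<close>

locale compact_full_support = finite_measure M for M :: "'a::euclidean_space measure" +
  fixes \<Omega> :: "'a set"
  assumes compact: "compact \<Omega>"
    and sets_M: "sets M = sets (restrict_space borel \<Omega>)"
    and full_support: "full_support_on \<Omega> M"
begin

lemma space_M: "space M = \<Omega>"
  using sets_eq_imp_space_eq[OF sets_M] by (simp add: space_restrict_space)

lemma L2_integrable: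
  assumes "f \<in> L2 M"
  shows "integrable M f"
proof -
  have "(\<lambda>_. 1) \<in> L2 M" by (simp add: L2_def)
  from L2_mult_integrable[OF assms this] show ?thesis by simp
qed

lemma continuous_measurable:
  assumes "continuous_on \<Omega> f"
  shows "f \<in> borel_measurable M"
  using borel_measurable_continuous_on_restrict[OF assms] measurable_cong_sets[OF sets_M refl]
  by blast

lemma continuous_bounded:
  fixes f :: "'a \<Rightarrow> real"
  assumes "continuous_on \<Omega> f"
  obtains B where "\<And>s. s \<in> \<Omega> \<Longrightarrow> \<bar>f s\<bar> \<le> B"
  using compact_imp_bounded[OF compact_continuous_image[OF assms compact]]
  by (auto simp: bounded_iff)

lemma kernel_bounded:
  fixes p :: "'a \<Rightarrow> 'a \<Rightarrow> real"
  assumes "continuous_on (\<Omega> \<times> \<Omega>) (\<lambda>(s, t). p s t)"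
  obtains B where "\<And>s t. s \<in> \<Omega> \<Longrightarrow> t \<in> \<Omega> \<Longrightarrow> \<bar>p s t\<bar> \<le> B"
proof -
  have "bounded ((\<lambda>(s, t). p s t) ` (\<Omega> \<times> \<Omega>))"
    by (intro compact_imp_bounded compact_continuous_image assms compact_Times compact)
  then obtain B where "\<And>z. z \<in> (\<lambda>(s, t). p s t) ` (\<Omega> \<times> \<Omega>) \<Longrightarrow> norm z \<le> B"
    unfolding bounded_iff by blast
  then have "\<bar>p s t\<bar> \<le> B" if "s \<in> \<Omega>" "t \<in> \<Omega>" for s t
    using that by fastforce
  then show ?thesis by (rule that)
qed

lemma continuous_integrable:
  fixes f :: "'a \<Rightarrow> real"
  assumes "continuous_on \<Omega> f"
  shows "integrable M f"
proof -
  obtain B where "\<And>s. s \<in> \<Omega> \<Longrightarrow> \<bar>f s\<bar> \<le> B" using continuous_bounded[OF assms] by blast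
  then show ?thesis
    using continuous_measurable[OF assms]
    by (intro integrable_const_bound[of _ B]) (auto simp: space_M)
qed

lemma continuous_L2: "continuous_on \<Omega> f \<Longrightarrow> f \<in> L2 M"
  by (auto simp: L2_def continuous_measurable intro!: continuous_integrable continuous_intros)

lemma continuous_mult_integrable:
  fixes f :: "'a \<Rightarrow> real"
  assumes "continuous_on \<Omega> f" "integrable M h"
  shows "integrable M (\<lambda>s. f s * h s)"
proof -
  obtain B where B: "\<And>s. s \<in> \<Omega> \<Longrightarrow> \<bar>f s\<bar> \<le> B" using continuous_bounded[OF assms(1)] by blast
  show ?thesis
  proof (rule Bochner_Integration.integrable_bound[where f = "\<lambda>s. B * h s"])
    show "AE s in M. norm (f s * h s) \<le> norm (B * h s)"
    proof (rule AE_I2)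
      fix s assume "s \<in> space M"
      then have "\<bar>f s\<bar> \<le> \<bar>B\<bar>" using B[of s] by (simp add: space_M)
      then show "norm (f s * h s) \<le> norm (B * h s)"
        by (simp add: abs_mult mult_right_mono)
    qed
  qed (use assms continuous_measurable[OF assms(1)] in auto)
qed

text \<open>The set where two continuous functions differ is relatively open, so full support gives
  it positive measure unless it is empty. This turns identities between classes into pointwise
  ones.\<close>

lemma AE_eq_imp_eq:
  fixes f g :: "'a \<Rightarrow> real"
  assumes f: "continuous_on \<Omega> f" and g: "continuous_on \<Omega> g"
    and ae: "AE s in M. f s = g s" and s: "s \<in> \<Omega>"
  shows "f s = g s"
proof (rule ccontr)
  assume ne: "f s \<noteq> g s"
  let ?U = "\<Omega> \<inter> (\<lambda>u. f u - g u) -` (- {0})"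
  have "openin (top_of_set \<Omega>) ?U"
    using f g by (intro continuous_openin_preimage_gen continuous_intros) auto
  then have pos: "0 < emeasure M ?U"
    using full_support s ne unfolding full_support_on_def
    by (elim allE[of _ ?U]) auto
  have "(\<lambda>u. f u - g u) \<in> borel_measurable M"
    using f g by (intro continuous_measurable continuous_intros)
  then have "?U \<in> sets M"
    using measurable_sets[of "\<lambda>u. f u - g u" M borel "- {0}"] by (simp add: space_M Int_commute)
  moreover have "{u \<in> space M. f u \<noteq> g u} = ?U" by (auto simp: space_M)
  ultimately have "emeasure M ?U = 0" using AE_iff_measurable[of ?U M "\<lambda>u. f u = g u"] ae by simp
  with pos show False by simp
qed

lemma section_continuous:
  assumes "continuous_on (\<Omega> \<times> \<Omega>) (\<lambda>(s, t). p s t)" "s \<in> \<Omega>"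
  shows "continuous_on \<Omega> (p s)"
proof -
  have "continuous_on \<Omega> (\<lambda>t. case (s, t) of (s, t) \<Rightarrow> p s t)"
    by (rule continuous_on_compose2[OF assms(1)]) (use assms(2) in \<open>auto intro!: continuous_intros\<close>)
  then show ?thesis by simp
qed

text \<open>Dominated convergence along sequences; a bound for \<open>p\<close> on the compact
  square supplies the dominating function.\<close>

lemma integral_op_continuous:
  fixes p :: "'a \<Rightarrow> 'a \<Rightarrow> real"
  assumes p: "continuous_on (\<Omega> \<times> \<Omega>) (\<lambda>(s, t). p s t)" and h: "integrable M h"
  shows "continuous_on \<Omega> (integral_op M p h)"
proof (rule continuous_on_sequentiallyI)
  fix u s assume s: "s \<in> \<Omega>" and u: "\<forall>n. u n \<in> \<Omega>" and lim: "u \<longlonglongrightarrow> s"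
  obtain B where B: "\<And>s t. s \<in> \<Omega> \<Longrightarrow> t \<in> \<Omega> \<Longrightarrow> \<bar>p s t\<bar> \<le> B"
    using kernel_bounded[OF p] by blast
  show "(\<lambda>n. integral_op M p h (u n)) \<longlonglongrightarrow> integral_op M p h s"
    unfolding integral_op_def
  proof (rule integral_dominated_convergence[where w = "\<lambda>t. B * \<bar>h t\<bar>"])
    show "AE t in M. (\<lambda>n. p (u n) t * h t) \<longlonglongrightarrow> p s t * h t"
    proof (rule AE_I2)
      fix t assume t: "t \<in> space M"
      have "(\<lambda>n. p (u n) t) \<longlonglongrightarrow> p s t"
        using continuous_on_tendsto_compose[OF p tendsto_Pair[OF lim tendsto_const], of t] s u t
        by (simp add: space_M)
      then show "(\<lambda>n. p (u n) t * h t) \<longlonglongrightarrow> p s t * h t" by (rule tendsto_mult_right)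
    qed
    show "AE t in M. norm (p (u n) t * h t) \<le> B * \<bar>h t\<bar>" for n
      using B u by (auto simp: space_M abs_mult intro!: mult_right_mono)
  qed (use h s u continuous_measurable[OF section_continuous[OF p]] in auto)
qed

text \<open>A continuous kernel is bounded on the compact square, hence integrable for the finite
  product measure once it is known to be measurable for the product sigma-algebra.\<close>

lemma kernel_Fubini:
  fixes p :: "'a \<Rightarrow> 'a \<Rightarrow> real"
  assumes p: "continuous_on (\<Omega> \<times> \<Omega>) (\<lambda>(s, t). p s t)"
  shows "(LINT s|M. LINT t|M. p s t) = (LINT t|M. LINT s|M. p s t)"
proof -
  interpret P: pair_sigma_finite M M ..
  interpret P2: finite_measure "M \<Otimes>\<^sub>M M"
    by (intro finite_measure_pair_measure finite_measure_axioms)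
  have sp: "space (M \<Otimes>\<^sub>M M) = \<Omega> \<times> \<Omega>"
    by (simp add: space_pair_measure space_M)
  have id: "(\<lambda>s. s) \<in> measurable M borel"
    by (rule continuous_measurable) (rule continuous_on_id)
  have "(\<lambda>z. (fst z, snd z)) \<in> measurable (M \<Otimes>\<^sub>M M) (borel \<Otimes>\<^sub>M borel)"
    by (intro measurable_Pair measurable_compose[OF measurable_fst id]
        measurable_compose[OF measurable_snd id])
  then have id2: "(\<lambda>z. z) \<in> measurable (M \<Otimes>\<^sub>M M) (borel :: ('a \<times> 'a) measure)"
    by (simp add: borel_prod)
  \<comment> \<open>Continuity of \<open>p\<close> is given on the square only. Its extension by 0
    off this closed set is Borel on the whole product space, and \<open>id2\<close> carries that
    over to the product of \<open>M\<close> with itself.\<close>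
  have "(\<lambda>z. if z \<in> \<Omega> \<times> \<Omega> then (\<lambda>(s, t). p s t) z else 0) \<in> borel_measurable borel"
    by (rule borel_measurable_continuous_on_if)
      (use compact p in \<open>auto intro: borel_closed closed_Times compact_imp_closed\<close>)
  from measurable_compose[OF id2 this]
  have meas: "(\<lambda>(s, t). p s t) \<in> borel_measurable (M \<Otimes>\<^sub>M M)"
    by (rule measurable_cong[THEN iffD1, rotated]) (auto simp: sp)
  obtain B where B: "\<And>s t. s \<in> \<Omega> \<Longrightarrow> t \<in> \<Omega> \<Longrightarrow> \<bar>p s t\<bar> \<le> B"
    using kernel_bounded[OF p] by blast
  have "integrable (M \<Otimes>\<^sub>M M) (\<lambda>(s, t). p s t)"
    using B meas by (intro P2.integrable_const_bound[of _ B]) (auto simp: sp)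
  from P.Fubini_integral[OF this] show ?thesis by simp
qed

end

section \<open>The integral operator as the adjoint of the embedding of the RKHS\<close>

locale mercer_rkhs = compact_full_support M \<Omega> + rkhs \<Omega> k H ip
  for M :: "'a::euclidean_space measure" and \<Omega> k H ip +
  assumes kernel_continuous: "continuous_on (\<Omega> \<times> \<Omega>) (\<lambda>(s, t). k s t)"
begin

lemma mem_continuous_on: "f \<in> H \<Longrightarrow> continuous_on \<Omega> f"
  using rkhs_mem_continuous_on[OF _ kernel_continuous] rkhs_axioms by blast

text \<open>The section varies the first argument of \<open>k\<close>, whereas the operator
  integrates over the second; symmetry of \<open>k\<close> reconciles them.\<close>

lemma integral_op_eq_inner:
  "s \<in> \<Omega> \<Longrightarrow> integral_op M k h s = L2_inner M (kernel_section \<Omega> k s) h"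
  unfolding integral_op_def L2_inner_def
  by (intro Bochner_Integration.integral_cong)
     (auto simp: kernel_section_def space_M kernel_symmetric)

text \<open>
  Since \<open>integral_op M k\<close> is the adjoint of the embedding of \<open>H\<close> into \<open>L\<^sup>2\<close>, its symmetry and positivity follow
  from those of the inner product of \<open>H\<close>.
\<close>

lemma integral_op_adjoint:
  assumes h: "integrable M h"
  obtains w where "w \<in> H" "\<And>s. s \<in> \<Omega> \<Longrightarrow> w s = integral_op M k h s"
    "\<And>f. f \<in> H \<Longrightarrow> ip w f = L2_inner M f h"
proof -
  obtain B where B: "\<And>s t. s \<in> \<Omega> \<Longrightarrow> t \<in> \<Omega> \<Longrightarrow> \<bar>k s t\<bar> \<le> B"
    using kernel_bounded[OF kernel_continuous] by blast
  have int: "integrable M (\<lambda>s. f s * h s)" if "f \<in> H" for f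
    using continuous_mult_integrable[OF mem_continuous_on[OF that] h] .
  have add: "L2_inner M (\<lambda>s. f s + g s) h = L2_inner M f h + L2_inner M g h"
    if "f \<in> H" "g \<in> H" for f g
    using int that by (simp add: L2_inner_def distrib_right)
  \<comment> \<open>The evaluation bound makes each \<open>f\<close> in \<open>H\<close> bounded by
    a multiple of its norm, so pairing with \<open>h\<close> costs only the integral of its absolute
    value.\<close>
  have bound: "\<bar>L2_inner M f h\<bar> \<le> (sqrt B * (LINT s|M. \<bar>h s\<bar>)) * sqrt (ip f f)" if f: "f \<in> H" for f
  proof -
    have "\<bar>L2_inner M f h\<bar> \<le> (LINT s|M. \<bar>f s * h s\<bar>)"
      unfolding L2_inner_def by (rule integral_abs_bound)
    also have "\<dots> \<le> (LINT s|M. sqrt B * sqrt (ip f f) * \<bar>h s\<bar>)"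
    proof (intro integral_mono)
      fix s assume "s \<in> space M"
      then have s: "s \<in> \<Omega>" by (simp add: space_M)
      have "\<bar>f s\<bar> \<le> sqrt (k s s) * sqrt (ip f f)" using abs_eval_le[OF s f] .
      also have "\<dots> \<le> sqrt B * sqrt (ip f f)"
        using B[OF s s] ip_nonneg[OF f] by (intro mult_right_mono) auto
      finally show "\<bar>f s * h s\<bar> \<le> sqrt B * sqrt (ip f f) * \<bar>h s\<bar>"
        by (simp add: abs_mult mult_right_mono)
    qed (use int[OF f] h in auto)
    finally show ?thesis by (simp add: mult_ac)
  qed
  obtain w where w: "w \<in> H" "\<And>f. f \<in> H \<Longrightarrow> ip w f = L2_inner M f h"
    using Riesz_representation[OF add L2_inner_scale_left bound] by blast
  have "w s = integral_op M k h s" if "s \<in> \<Omega>" for s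
    using reproducing[OF that w(1)] w(2)[OF section_mem[OF that]] integral_op_eq_inner[OF that]
    by simp
  then show ?thesis using that w by blast
qed

lemma integral_op_k_continuous:
  "integrable M h \<Longrightarrow> continuous_on \<Omega> (integral_op M k h)"
  by (rule integral_op_continuous[OF kernel_continuous])

text \<open>Both sides equal \<open>ip v w\<close> for the elements \<open>v\<close>,
  \<open>w\<close> of \<open>H\<close> that represent \<open>f\<close> and \<open>g\<close>.\<close>

lemma integral_op_symmetric:
  assumes "integrable M f" "integrable M g"
  shows "L2_inner M (integral_op M k f) g = L2_inner M f (integral_op M k g)"
proof -
  obtain v where v: "v \<in> H" "\<And>s. s \<in> \<Omega> \<Longrightarrow> v s = integral_op M k f s"
    "\<And>h. h \<in> H \<Longrightarrow> ip v h = L2_inner M h f"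
    using integral_op_adjoint[OF assms(1)] by blast
  obtain w where w: "w \<in> H" "\<And>s. s \<in> \<Omega> \<Longrightarrow> w s = integral_op M k g s"
    "\<And>h. h \<in> H \<Longrightarrow> ip w h = L2_inner M h g"
    using integral_op_adjoint[OF assms(2)] by blast
  have "L2_inner M (integral_op M k f) g = L2_inner M v g"
    using v by (intro L2_inner_cong) (auto simp: space_M)
  also have "\<dots> = L2_inner M w f" using v w ip_commute by metis
  also have "\<dots> = L2_inner M f w" by (rule L2_inner_commute)
  also have "\<dots> = L2_inner M f (integral_op M k g)"
    using w by (intro L2_inner_cong) (auto simp: space_M)
  finally show ?thesis .
qed

text \<open>The value is \<open>ip v v\<close>, where \<open>v\<close> in \<open>H\<close>
  represents \<open>f\<close>.\<close>

lemma integral_op_nonneg: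
  assumes "integrable M f"
  shows "0 \<le> L2_inner M (integral_op M k f) f"
proof -
  obtain v where v: "v \<in> H" "\<And>s. s \<in> \<Omega> \<Longrightarrow> v s = integral_op M k f s"
    "\<And>h. h \<in> H \<Longrightarrow> ip v h = L2_inner M h f"
    using integral_op_adjoint[OF assms(1)] by blast
  have "L2_inner M (integral_op M k f) f = L2_inner M v f"
    using v by (intro L2_inner_cong) (auto simp: space_M)
  also have "\<dots> = ip v v" using v by metis
  finally show ?thesis using ip_nonneg[OF v(1)] by simp
qed

end

section \<open>The regularized operator \<open>A\<close> and its inverse\<close>

locale regularized_mercer_rkhs = mercer_rkhs M \<Omega> k H ip
  for M :: "'a::euclidean_space measure" and \<Omega> k H ip +
  fixes c \<gamma> :: real
  assumes c_pos: "c > 0" and \<gamma>_pos: "\<gamma> > 0"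
begin

abbreviation "K \<equiv> integral_op M k"
abbreviation "A \<equiv> A_op M k c \<gamma>"

lemma K_L2: "h \<in> L2 M \<Longrightarrow> K h \<in> L2 M"
  by (rule continuous_L2[OF integral_op_k_continuous[OF L2_integrable]])

lemma A_L2: "h \<in> L2 M \<Longrightarrow> A h \<in> L2 M"
  unfolding A_op_def by (intro L2_add L2_scale K_L2)

lemma A_continuous: "continuous_on \<Omega> h \<Longrightarrow> continuous_on \<Omega> (A h)"
  unfolding A_op_def
  by (intro continuous_intros integral_op_k_continuous continuous_integrable)

lemma K_diff:
  assumes "f \<in> L2 M" "g \<in> L2 M" "s \<in> \<Omega>"
  shows "K (\<lambda>t. f t - g t) s = K f s - K g s"
proof -
  have "k s \<in> L2 M" using assms(3) by (intro continuous_L2 section_continuous[OF kernel_continuous])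
  then show ?thesis
    using assms by (simp add: integral_op_def right_diff_distrib L2_mult_integrable)
qed

lemma A_symmetric:
  assumes "f \<in> L2 M" "g \<in> L2 M"
  shows "L2_inner M (A f) g = L2_inner M f (A g)"
proof -
  have *: "L2_inner M (A f) g = c * L2_inner M (K f) g + \<gamma> * L2_inner M f g"
    if "f \<in> L2 M" "g \<in> L2 M" for f g
    unfolding A_op_def
    using that by (simp add: L2_inner_add_left L2_scale K_L2 L2_inner_scale_left)
  show ?thesis
    using *[OF assms] *[OF assms(2,1)] integral_op_symmetric[of f g] assms
    by (simp add: L2_integrable L2_inner_commute)
qed

text \<open>Coercivity: pairing \<open>A h\<close> with \<open>h\<close> gives at least \<gamma>
  times the squared norm of \<open>h\<close>, because \<open>K\<close> is positive.\<close>

lemma A_injective: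
  assumes h: "h \<in> L2 M" and ae: "AE s in M. A h s = 0"
  shows "AE s in M. h s = 0"
proof -
  have "L2_inner M (A h) h = 0"
    unfolding L2_inner_def by (rule integral_eq_zero_AE) (use ae in auto)
  moreover have "L2_inner M (A h) h = c * L2_inner M (K h) h + \<gamma> * L2_inner M h h"
    unfolding A_op_def using h by (simp add: L2_inner_add_left L2_scale K_L2 L2_inner_scale_left)
  moreover have "0 \<le> c * L2_inner M (K h) h"
    using integral_op_nonneg[OF L2_integrable[OF h]] c_pos by simp
  moreover have "0 \<le> L2_inner M h h" by (simp add: L2_inner_def)
  ultimately have "L2_inner M h h = 0"
    using \<gamma>_pos by (smt (verit) mult_pos_pos)
  then show ?thesis by (rule L2_inner_self_eq_0[OF h])
qed

text \<open>The witness \<open>h\<close> only shows that the choice in \<open>L2_inverse\<close>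
  ranges over a nonempty set; without a preimage the chosen function would be arbitrary.\<close>

lemma A_inv_solves:
  assumes "h \<in> L2 M" "AE s in M. A h s = f s"
  shows "A_inv M k c \<gamma> f \<in> L2 M" "AE s in M. A (A_inv M k c \<gamma> f) s = f s"
proof -
  have "\<exists>h. h \<in> L2 M \<and> (AE s in M. A h s = f s)" using assms by blast
  from someI_ex[OF this]
  show "A_inv M k c \<gamma> f \<in> L2 M" "AE s in M. A (A_inv M k c \<gamma> f) s = f s"
    by (simp_all add: A_inv_def L2_inverse_def)
qed

lemma A_inv_A:
  assumes h: "h \<in> L2 M"
  shows "AE s in M. A_inv M k c \<gamma> (A h) s = h s"
proof -
  let ?g = "A_inv M k c \<gamma> (A h)"
  have g: "?g \<in> L2 M" and ae: "AE s in M. A ?g s = A h s"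
    using A_inv_solves[OF h, of "A h"] by auto
  have "AE s in M. A (\<lambda>t. ?g t - h t) s = 0"
    using ae by (rule AE_mp) (auto intro!: AE_I2 simp: A_op_def K_diff g h space_M algebra_simps)
  from A_injective[OF L2_diff[OF g h] this] show ?thesis by simp
qed

text \<open>Continuity upgrades the equation to every point of \<Omega>, where it can be solved for
  \<open>h\<close>; the remaining term \<open>K h\<close> comes from \<open>H\<close> by
  \<open>integral_op_adjoint\<close>.\<close>

lemma A_preimage_decomposition:
  assumes h: "continuous_on \<Omega> h" and y: "continuous_on \<Omega> y" and ae: "AE s in M. A h s = y s"
  obtains g where "g \<in> H" "\<And>s. s \<in> \<Omega> \<Longrightarrow> h s = g s + y s / \<gamma>"
proof -
  obtain w where w: "w \<in> H" "\<And>s. s \<in> \<Omega> \<Longrightarrow> w s = K h s"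
    "\<And>f. f \<in> H \<Longrightarrow> ip w f = L2_inner M f h"
    using integral_op_adjoint[OF continuous_integrable[OF h]] by blast
  have "h s = - (c / \<gamma>) * w s + y s / \<gamma>" if s: "s \<in> \<Omega>" for s
    using AE_eq_imp_eq[OF A_continuous[OF h] y ae s] w(2)[OF s] \<gamma>_pos
    by (simp add: A_op_def field_simps)
  with scale_mem[OF w(1)] show ?thesis by (rule that)
qed

lemma K_cong_AE:
  assumes "AE s in M. f s = g s" "f \<in> L2 M" "g \<in> L2 M" "s \<in> \<Omega>"
  shows "K f s = K g s"
  unfolding integral_op_def
  using assms continuous_measurable[OF section_continuous[OF kernel_continuous \<open>s \<in> \<Omega>\<close>]]
  by (intro integral_cong_AE) (auto simp: L2_def)

section \<open>The kernel \<open>r0\<close> as a resolvent kernel of \<open>K\<close>\<close>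

context
  fixes r0
  assumes r0: "continuous_kernel_of M (R0_op M k c \<gamma>) r0"
begin

lemma r0_continuous: "continuous_on (\<Omega> \<times> \<Omega>) (\<lambda>(s, t). r0 s t)"
  using r0 by (simp add: continuous_kernel_of_def space_M)

lemma r0_section_continuous: "s \<in> \<Omega> \<Longrightarrow> continuous_on \<Omega> (r0 s)"
  by (rule section_continuous[OF r0_continuous])

text \<open>
  Surjectivity of \<open>A\<close> is not known at this point, so the hypothesis on \<open>r0\<close> is exploited only on
  functions \<open>A h\<close>, where \<open>A_inv\<close> is not a junk value.
\<close>

lemma R0_A:
  assumes h: "h \<in> L2 M" and s: "s \<in> \<Omega>"
  shows "integral_op M r0 (A h) s = K h s"
proof (rule AE_eq_imp_eq[OF _ _ _ s])
  have "A_inv M k c \<gamma> (A h) \<in> L2 M" using A_inv_solves[OF h, of "A h"] by simp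
  then have "K (A_inv M k c \<gamma> (A h)) t = K h t" if "t \<in> \<Omega>" for t
    using K_cong_AE[OF A_inv_A[OF h] _ h that] by blast
  moreover have "AE t in M. integral_op M r0 (A h) t = R0_op M k c \<gamma> (A h) t"
    using r0 A_L2[OF h] by (simp add: continuous_kernel_of_def)
  ultimately show "AE t in M. integral_op M r0 (A h) t = K h t"
    by (elim AE_mp) (auto intro!: AE_I2 simp: R0_op_def space_M)
qed (use h in \<open>auto intro!: integral_op_continuous r0_continuous kernel_continuous
       L2_integrable A_L2\<close>)

text \<open>The difference \<open>?h\<close> of the two sides is tested against itself. Symmetry
  moves \<open>A\<close> from \<open>r0 s\<close> onto \<open>?h\<close>, where \<open>R0_A\<close>
  evaluates the pairing as \<open>K ?h s\<close>, which is also the pairing of \<open>k s\<close>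
  with \<open>?h\<close>; so \<open>?h\<close> has norm 0.\<close>

lemma A_r0_section:
  assumes s: "s \<in> \<Omega>" and t: "t \<in> \<Omega>"
  shows "A (r0 s) t = k s t"
proof -
  let ?h = "\<lambda>t. A (r0 s) t - k s t"
  have r: "r0 s \<in> L2 M" and ks: "k s \<in> L2 M"
    using s by (auto intro!: continuous_L2 r0_section_continuous
        section_continuous[OF kernel_continuous])
  have h: "?h \<in> L2 M" using r ks by (intro L2_diff A_L2)
  have "L2_inner M (A (r0 s)) ?h = L2_inner M (r0 s) (A ?h)"
    by (rule A_symmetric[OF r h])
  also have "\<dots> = K ?h s"
    using R0_A[OF h s] by (simp add: integral_op_def L2_inner_def)
  also have "\<dots> = L2_inner M (k s) ?h"
    by (simp add: integral_op_def L2_inner_def)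
  finally have "L2_inner M ?h ?h = 0"
    using L2_inner_diff_left[OF A_L2[OF r] ks h] by simp
  from L2_inner_self_eq_0[OF h this] have ae: "AE t in M. A (r0 s) t = k s t" by simp
  show ?thesis
    by (rule AE_eq_imp_eq[OF _ _ ae t])
      (use s in \<open>auto intro!: A_continuous r0_section_continuous
        section_continuous[OF kernel_continuous]\<close>)
qed

text \<open>\<open>A_r0_section\<close> expresses \<open>\<gamma> * r0 s t\<close> through
  \<open>k s t\<close> and the pairing of \<open>A (r0 t)\<close> with \<open>r0 s\<close>. Both are
  symmetric in \<open>s\<close> and \<open>t\<close>, the latter because \<open>A\<close>
  is.\<close>

lemma r0_symmetric:
  assumes s: "s \<in> \<Omega>" and t: "t \<in> \<Omega>"
  shows "r0 s t = r0 t s"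
proof -
  have r: "r0 s \<in> L2 M" if "s \<in> \<Omega>" for s
    using that by (intro continuous_L2 r0_section_continuous)
  have eq: "\<gamma> * r0 s t = k s t - c * L2_inner M (A (r0 t)) (r0 s)"
    if s: "s \<in> \<Omega>" and t: "t \<in> \<Omega>" for s t
  proof -
    have "K (r0 s) t = L2_inner M (k t) (r0 s)"
      by (simp add: integral_op_def L2_inner_def)
    also have "\<dots> = L2_inner M (A (r0 t)) (r0 s)"
      using t by (intro L2_inner_cong) (auto simp: space_M A_r0_section)
    finally show ?thesis using A_r0_section[OF s t] by (simp add: A_op_def)
  qed
  have "L2_inner M (A (r0 t)) (r0 s) = L2_inner M (A (r0 s)) (r0 t)"
    using A_symmetric[OF r r] s t by (metis L2_inner_commute)
  then have "\<gamma> * r0 s t = \<gamma> * r0 t s"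
    using eq[OF s t] eq[OF t s] kernel_symmetric[OF s t] by simp
  then show ?thesis using \<gamma>_pos by simp
qed

text \<open>Here the right-hand side of the equation solved by the section is itself a section of
  \<open>k\<close>, so the term divided by \<gamma> is absorbed into \<open>H\<close> and no
  combination of the regressors appears.\<close>

lemma r0_section_mem:
  assumes t: "t \<in> \<Omega>"
  obtains g where "g \<in> H" "\<And>s. s \<in> \<Omega> \<Longrightarrow> r0 s t = g s"
proof -
  obtain g where g: "g \<in> H" "\<And>s. s \<in> \<Omega> \<Longrightarrow> r0 t s = g s + k t s / \<gamma>"
  proof (rule A_preimage_decomposition[of "r0 t" "k t"])
    show "AE s in M. A (r0 t) s = k t s"
      using t by (intro AE_I2) (simp add: space_M A_r0_section)
  qed (use t in \<open>auto intro!: r0_section_continuous section_continuous[OF kernel_continuous]\<close>)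
  show ?thesis
  proof
    show "(\<lambda>s. g s + 1 / \<gamma> * kernel_section \<Omega> k t s) \<in> H"
      using g t by (intro add_mem scale_mem section_mem)
    show "r0 s t = g s + 1 / \<gamma> * kernel_section \<Omega> k t s" if s: "s \<in> \<Omega>" for s
      using g(2)[OF s] r0_symmetric[OF s t] kernel_symmetric[OF s t] s
      by (simp add: kernel_section_def)
  qed
qed

text \<open>The resolvent identity: the inverse of \<open>A\<close> is the identity minus
  \<open>c\<close> times the operator of \<open>r0\<close>, divided by \<gamma>. It exhibits a
  preimage under \<open>A\<close> for every continuous function, so that \<open>A_inv\<close> is
  meaningful there.\<close>

lemma A_resolvent:
  assumes y: "continuous_on \<Omega> y" and u: "u \<in> \<Omega>"
  shows "A (\<lambda>s. (y s - c * integral_op M r0 y s) / \<gamma>) u = y u"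
proof -
  let ?R = "integral_op M r0 y"
  have yL: "y \<in> L2 M" using y by (rule continuous_L2)
  have Rc: "continuous_on \<Omega> ?R"
    by (intro integral_op_continuous r0_continuous continuous_integrable y)
  have RL: "?R \<in> L2 M" using Rc by (rule continuous_L2)
  have sec: "k u \<in> L2 M" "r0 u \<in> L2 M"
    using u by (auto intro!: continuous_L2 r0_section_continuous
        section_continuous[OF kernel_continuous])
  have cont: "continuous_on (\<Omega> \<times> \<Omega>) (\<lambda>(s, t). k u s * (r0 s t * y t))"
    using r0_continuous section_continuous[OF kernel_continuous u] y
    unfolding case_prod_beta'
    by (intro continuous_intros continuous_on_compose2[of \<Omega> "k u" _ fst]
        continuous_on_compose2[of \<Omega> y _ snd]) auto
  have "K ?R u = (LINT s|M. LINT t|M. k u s * (r0 s t * y t))"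
    by (simp add: integral_op_def)
  \<comment> \<open>After the exchange, symmetry of \<open>r0\<close> turns the inner integral into
    \<open>K (r0 t) u * y t\<close>, which \<open>A_r0_section\<close> evaluates in closed
    form.\<close>
  also have "\<dots> = (LINT t|M. LINT s|M. k u s * (r0 s t * y t))"
    by (rule kernel_Fubini[OF cont])
  also have "\<dots> = (LINT t|M. (k u t - \<gamma> * r0 u t) / c * y t)"
  proof (intro Bochner_Integration.integral_cong refl)
    fix t assume "t \<in> space M"
    then have t: "t \<in> \<Omega>" by (simp add: space_M)
    have "(LINT s|M. k u s * (r0 s t * y t)) = (LINT s|M. k u s * r0 t s * y t)"
      using t by (intro Bochner_Integration.integral_cong) (auto simp: space_M r0_symmetric)
    also have "\<dots> = K (r0 t) u * y t" by (simp add: integral_op_def)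
    also have "K (r0 t) u = (k u t - \<gamma> * r0 u t) / c"
      using A_r0_section[OF t u] r0_symmetric[OF t u] kernel_symmetric[OF t u] c_pos
      by (simp add: A_op_def field_simps)
    finally show "(LINT s|M. k u s * (r0 s t * y t)) = (k u t - \<gamma> * r0 u t) / c * y t" .
  qed
  also have "\<dots> = (LINT t|M. (1 / c) * (k u t * y t) - (\<gamma> / c) * (r0 u t * y t))"
    by (intro Bochner_Integration.integral_cong) (auto simp: field_simps diff_divide_distrib)
  also have "\<dots> = (1 / c) * K y u - (\<gamma> / c) * ?R u"
    using L2_mult_integrable[OF sec(1) yL] L2_mult_integrable[OF sec(2) yL]
    by (simp add: integral_op_def)
  finally have KR: "c * K ?R u = K y u - \<gamma> * ?R u"
    using c_pos by (simp add: field_simps)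
  have "K (\<lambda>s. (1 / \<gamma>) * y s - (c / \<gamma>) * ?R s) u
      = K (\<lambda>s. (1 / \<gamma>) * y s) u - K (\<lambda>s. (c / \<gamma>) * ?R s) u"
    by (intro K_diff L2_scale yL RL u)
  also have "\<dots> = (1 / \<gamma>) * K y u - (c / \<gamma>) * K ?R u"
    by (simp add: integral_op_def mult.left_commute)
  finally have "K (\<lambda>s. (y s - c * ?R s) / \<gamma>) u = (K y u - c * K ?R u) / \<gamma>"
    by (simp add: diff_divide_distrib)
  then show ?thesis
    using KR \<gamma>_pos by (simp add: A_op_def field_simps)
qed

text \<open>\<open>A_resolvent\<close> gives a preimage of \<open>y\<close>, so \<open>A_inv\<close>
  really solves the equation. The continuous representative \<open>a\<close> solves it too, since
  \<open>K\<close> ignores null sets, and \<open>A_preimage_decomposition\<close> applies to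
  \<open>a\<close>.\<close>

lemma A_inv_continuous_decomposition:
  assumes y: "continuous_on \<Omega> y" and a: "continuous_L2_rep M (A_inv M k c \<gamma> y) a"
  obtains g where "g \<in> H" "\<And>s. s \<in> \<Omega> \<Longrightarrow> a s = g s + y s / \<gamma>"
proof -
  let ?h = "\<lambda>s. (y s - c * integral_op M r0 y s) / \<gamma>"
  have "continuous_on \<Omega> ?h"
    using y \<gamma>_pos by (intro continuous_intros integral_op_continuous r0_continuous
        continuous_integrable) auto
  moreover have "AE s in M. A ?h s = y s"
    by (intro AE_I2) (simp add: space_M A_resolvent[OF y])
  ultimately have L: "A_inv M k c \<gamma> y \<in> L2 M" and ae: "AE s in M. A (A_inv M k c \<gamma> y) s = y s"
    using A_inv_solves continuous_L2 by blast+
  have ac: "continuous_on \<Omega> a" and a_eq: "AE s in M. a s = A_inv M k c \<gamma> y s"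
    using a by (auto simp: continuous_L2_rep_def space_M)
  have "K a s = K (A_inv M k c \<gamma> y) s" if "s \<in> \<Omega>" for s
    using K_cong_AE[OF a_eq continuous_L2[OF ac] L that] .
  then have "AE s in M. A a s = y s"
    using ae a_eq by (elim AE_mp) (auto intro!: AE_I2 simp: A_op_def space_M)
  from A_preimage_decomposition[OF ac y this] that show ?thesis by blast
qed

end

end

section \<open>The sum of the RKHS and the span of the regressors, and the final assembly\<close>

lemma X_op_add: "X_op x (\<beta> + \<beta>') s = X_op x \<beta> s + X_op x \<beta>' s"
  by (simp add: X_op_def distrib_right sum.distrib)

lemma X_op_scale: "X_op x (b *\<^sub>R \<beta>) s = b * X_op x \<beta> s"
  by (simp add: X_op_def sum_distrib_left mult.assoc)

lemma X_op_axis: "X_op x (axis i 1) s = x i s"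
  by (simp add: X_op_def axis_def if_distrib[of "\<lambda>b. b * _"] cong: if_cong)

text \<open>Agreement is asked on \<Omega> only: the elements of \<open>H\<close> vanish outside,
  but \<open>r_inf\<close> and \<open>X_op\<close> are not cut off there.\<close>

definition plus_span ::
  "'a set \<Rightarrow> ('a \<Rightarrow> real) set \<Rightarrow> ('p::finite \<Rightarrow> 'a \<Rightarrow> real) \<Rightarrow> ('a \<Rightarrow> real) set" where
  "plus_span \<Omega> H x = {\<phi>. \<exists>g\<in>H. \<exists>\<beta>. \<forall>u\<in>\<Omega>. \<phi> u = g u + X_op x \<beta> u}"

context hilbert_function_space
begin

lemma plus_spanI:
  "g \<in> H \<Longrightarrow> (\<And>u. u \<in> \<Omega> \<Longrightarrow> \<phi> u = g u + X_op x \<beta> u) \<Longrightarrow> \<phi> \<in> plus_span \<Omega> H x"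
  unfolding plus_span_def by blast

lemma plus_span_add:
  assumes "\<phi> \<in> plus_span \<Omega> H x" "\<psi> \<in> plus_span \<Omega> H x"
  shows "(\<lambda>u. \<phi> u + \<psi> u) \<in> plus_span \<Omega> H x"
proof -
  obtain g \<beta> g' \<beta>' where "g \<in> H" "\<forall>u\<in>\<Omega>. \<phi> u = g u + X_op x \<beta> u"
    "g' \<in> H" "\<forall>u\<in>\<Omega>. \<psi> u = g' u + X_op x \<beta>' u"
    using assms unfolding plus_span_def by blast
  then show ?thesis
    by (intro plus_spanI[OF add_mem, of g g' _ _ "\<beta> + \<beta>'"]) (auto simp: X_op_add)
qed

lemma plus_span_scale:
  assumes "\<phi> \<in> plus_span \<Omega> H x"
  shows "(\<lambda>u. b * \<phi> u) \<in> plus_span \<Omega> H x"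
proof -
  obtain g \<beta> where "g \<in> H" "\<forall>u\<in>\<Omega>. \<phi> u = g u + X_op x \<beta> u"
    using assms unfolding plus_span_def by blast
  then show ?thesis
    by (intro plus_spanI[OF scale_mem, of g _ b _ "b *\<^sub>R \<beta>"]) (auto simp: X_op_scale distrib_left)
qed

lemma plus_span_sum:
  assumes "\<And>i. i \<in> I \<Longrightarrow> \<phi> i \<in> plus_span \<Omega> H x"
  shows "(\<lambda>u. \<Sum>i\<in>I. b i * \<phi> i u) \<in> plus_span \<Omega> H x"
proof -
  have "(\<lambda>_. 0) \<in> plus_span \<Omega> H x"
    using zero_mem by (rule plus_spanI[of _ _ _ 0]) (simp add: X_op_def)
  then show ?thesis
    using assms
  proof (induction I rule: infinite_finite_induct)
    case (insert i I)
    then show ?case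
      using plus_span_add[OF plus_span_scale[of "\<phi> i" x "b i"],
          of "\<lambda>u. \<Sum>i\<in>I. b i * \<phi> i u"] by simp
  qed simp_all
qed

end

text \<open>With the second argument frozen at \<open>t\<close>, the kernel is \<open>r0\<close>
  plus a linear combination of the functions \<open>a i\<close>, and each piece has been decomposed
  already.\<close>

lemma (in regularized_mercer_rkhs) r_inf_section_plus_span:
  fixes x :: "'p::finite \<Rightarrow> 'a \<Rightarrow> real"
  assumes x: "\<And>i. continuous_on \<Omega> (x i)"
    and a: "\<And>i. continuous_L2_rep M (A_inv M k c \<gamma> (x i)) (a i)"
    and r0: "continuous_kernel_of M (R0_op M k c \<gamma>) r0" and t: "t \<in> \<Omega>"
  shows "(\<lambda>u. r_inf c \<gamma> S r0 a u t) \<in> plus_span \<Omega> H x"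
proof -
  have "a i \<in> plus_span \<Omega> H x" for i
  proof -
    obtain g where "g \<in> H" "\<And>s. s \<in> \<Omega> \<Longrightarrow> a i s = g s + x i s / \<gamma>"
      using A_inv_continuous_decomposition[OF r0 x a] by metis
    then show ?thesis
      by (intro plus_spanI[of g _ _ "(1 / \<gamma>) *\<^sub>R axis i 1"]) (auto simp: X_op_scale X_op_axis)
  qed
  \<comment> \<open>Grouping the double sum by \<open>i\<close> collects everything that depends on
    \<open>t\<close> into the weight of \<open>a i\<close>.\<close>
  then have "(\<lambda>u. \<Sum>i\<in>UNIV. (\<Sum>j\<in>UNIV. \<gamma> / c * matrix_inv S $ i $ j * a j t) * a i u)
      \<in> plus_span \<Omega> H x"
    by (intro plus_span_sum)
  moreover have "(\<lambda>u. r0 u t) \<in> plus_span \<Omega> H x"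
  proof -
    obtain g where "g \<in> H" "\<And>s. s \<in> \<Omega> \<Longrightarrow> r0 s t = g s"
      using r0_section_mem[OF r0 t] by metis
    then show ?thesis by (intro plus_spanI[of g _ _ 0]) (auto simp: X_op_def)
  qed
  ultimately have "(\<lambda>u. r0 u t + (\<Sum>i\<in>UNIV. (\<Sum>j\<in>UNIV. \<gamma> / c * matrix_inv S $ i $ j * a j t) * a i u))
      \<in> plus_span \<Omega> H x"
    by (rule plus_span_add[rotated])
  also have "(\<lambda>u. r0 u t + (\<Sum>i\<in>UNIV. (\<Sum>j\<in>UNIV. \<gamma> / c * matrix_inv S $ i $ j * a j t) * a i u))
      = (\<lambda>u. r_inf c \<gamma> S r0 a u t)"
    by (simp add: r_inf_def sum_distrib_left sum_distrib_right mult_ac)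
  finally show ?thesis .
qed

theorem proposition3p1:
  fixes c \<gamma> :: real
    and \<Omega> :: "'a::euclidean_space set"
    and M :: "'a measure"
    and k :: "'a \<Rightarrow> 'a \<Rightarrow> real"
    and x :: "'p::finite \<Rightarrow> 'a \<Rightarrow> real"
    and a :: "'p \<Rightarrow> 'a \<Rightarrow> real"
    and r0 :: "'a \<Rightarrow> 'a \<Rightarrow> real"
    and HK HR :: "('a \<Rightarrow> real) set"
    and ipK ipR :: "('a \<Rightarrow> real) \<Rightarrow> ('a \<Rightarrow> real) \<Rightarrow> real"
    and d :: nat
    and s :: "nat \<Rightarrow> 'a"
    and f :: "'a \<Rightarrow> real"
  assumes "c > 0" and "\<gamma> > 0"
    and "compact \<Omega>"
    and "sets M = sets (restrict_space borel \<Omega>)" and "finite_measure M"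
    and "full_support_on \<Omega> M"
    and "continuous_on (\<Omega> \<times> \<Omega>) (\<lambda>(s, t). k s t)"
    and "symmetric_kernel \<Omega> k"
    and "positive_definite_kernel \<Omega> k"
    and "rkhs \<Omega> k HK ipK"
    and "\<forall>j. continuous_on \<Omega> (x j)"
    and "linearly_independent_on \<Omega> x"
    and "\<forall>i. continuous_L2_rep M (A_inv M k c \<gamma> (x i)) (a i)"
    and "continuous_kernel_of M (R0_op M k c \<gamma>) r0"
    and "rkhs \<Omega> (r_inf c \<gamma> (S_mat M k c \<gamma> x) r0 a) HR ipR"
    and "\<forall>i\<in>{1..d}. s i \<in> \<Omega>"
    and "is_maximizer (ell c d s ipR) HR f"
  shows "\<exists>g\<in>HK. \<exists>\<beta> :: real ^ 'p. \<forall>u\<in>\<Omega>. f u = g u + X_op x \<beta> u"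
proof -
  interpret regularized_mercer_rkhs M \<Omega> k HK ipK c \<gamma>
    using assms by (simp add: regularized_mercer_rkhs_def regularized_mercer_rkhs_axioms_def
        mercer_rkhs_def mercer_rkhs_axioms_def compact_full_support_def
        compact_full_support_axioms_def)
  let ?r = "r_inf c \<gamma> (S_mat M k c \<gamma> x) r0 a"
  \<comment> \<open>Two function spaces are in play: unqualified facts concern \<open>HK\<close>,
    those prefixed by \<open>R\<close> the space with kernel \<open>?r\<close>, in which
    \<open>f\<close> maximizes.\<close>
  interpret R: rkhs \<Omega> ?r HR ipR by fact
  have "(\<lambda>u. \<Sum>i=1..d. 2 / f (s i) * ?r u (s i)) \<in> plus_span \<Omega> HK x"
    using assms by (intro plus_span_sum r_inf_section_plus_span) auto
  moreover have "\<forall>u\<in>\<Omega>. f u = (\<Sum>i=1..d. 2 / f (s i) * ?r u (s i))"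
    using assms by (intro R.maximizer_expansion[of c]) auto
  ultimately show ?thesis by (simp add: plus_span_def)
qed

end
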